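(* Consider the randomized gossip algorithm with unreliable communication on $n\ge 3$ nodes, with node pair selection matrix $A=[a_{ij}]$ and communication probabilities $\{P_k^+\}_{k\ge0},\{P_k^-\}_{k\ge0}$ (as defined in the context). Suppose that communication is independent, i.e. the events $\mathbb{E}_k^+$ and $\mathbb{E}_k^-$ are independent for all $k$, and that both the underlying digraph $\mathcal{G}_0$ and its converse graph $\mathcal{G}_0^T$ are quasi-strongly connected. Then global a.s. consensus is achieved if and only if $\sum_{k=0}^\infty(P_k^++P_k^-)=\infty$.
   Context: Network model. The node set is $\mathcal{V}=\{1,\dots,n\}$, $n\ge3$. $A=[a_{ij}]\in\mathbb{R}^{n\times n}$ is a stochastic matrix (nonnegative entries, each row sums to $1$). The underlying digraph is $\mathcal{G}_0=(\mathcal{V},\mathcal{E}_0)$ with $(j,i)\in\mathcal{E}_0$ if and only if $a_{ij}>0$. Its converse graph $\mathcal{G}_0^T$ is obtained by reversing all arcs. A digraph is quasi-strongly connected if it has a center, i.e. a node from which every other node is reachable by a directed path. Node pair selection process. Independently at each time $k=0,1,2,\dots$, a node $i\in\mathcal{V}$ is drawn with probability $1/n$, and then node $i$ picks the (ordered) pair $(i,j)$ with probability $a_{ij}$. Node communication process. $\{P_k^+\}_{k\ge0}$ and $\{P_k^-\}_{k\ge0}$ are deterministic sequences in $[0,1]$. Independently over time, and independently of the node states and of the node pair selection process, $\mathbf{P}(\mathbb{E}_k^+)=P_k^+$ and $\mathbf{P}(\mathbb{E}_k^-)=P_k^-$, where $\mathbb{E}_k^+$ is the event that node $i$ receives $x_j(k)$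 when $(i,j)$ is selected at time $k$, and $\mathbb{E}_k^-$ is the event that node $j$ receives $x_i(k)$ when $(i,j)$ is selected at time $k$. Algorithm. Let $k_0\ge0$ be an arbitrary integer initial time and $x(k_0)=x^0\in\mathbb{R}^n$ a deterministic initial condition. For $k\ge k_0$, $x_i(k+1)=\frac12x_i(k)+\frac12x_j(k)$ if $(i,j)$ or $(j,i)$ is selected at time $k$ and $i$ receives $x_j(k)$; otherwise $x_i(k+1)=x_i(k)$. Consensus. Let $\mathcal{H}(k)=\max_i x_i(k)-\min_i x_i(k)$. Global a.s. consensus is achieved if $\mathbf{P}(\lim_{k\to\infty}\mathcal{H}(k)=0)=1$ for any initial condition $x^0\in\mathbb{R}^n$ (with $k_0\ge 0$ arbitrary). *)

theory Defs
  imports "HOL-Probability.Probability"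
begin

text \<open>
  Nodes are the elements of a finite type \<open>'n\<close>, so that \<open>n = CARD('n)\<close>.
\<close>

definition stochastic_matrix :: "real ^ 'n ^ 'n \<Rightarrow> bool" where
  "stochastic_matrix A \<longleftrightarrow>
     (\<forall>i j. 0 \<le> A $ i $ j) \<and> (\<forall>i. (\<Sum>j\<in>UNIV. A $ i $ j) = 1)"

text \<open>
  The arc points from \<open>j\<close> to \<open>i\<close> when \<open>i\<close> may select \<open>j\<close>.  The converse graph is the
  converse relation.
\<close>

definition underlying_digraph :: "real ^ 'n ^ 'n \<Rightarrow> ('n \<times> 'n) set" where
  "underlying_digraph A = {(j, i). A $ i $ j > 0}"

definition is_center :: "('n \<times> 'n) set \<Rightarrow> 'n \<Rightarrow> bool" where
  "is_center E c \<longleftrightarrow> (\<forall>v. v \<noteq> c \<longrightarrow> (c, v) \<in> E\<^sup>+)"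

definition quasi_strongly_connected :: "('n \<times> 'n) set \<Rightarrow> bool" where
  "quasi_strongly_connected E \<longleftrightarrow> (\<exists>c. is_center E c)"

text \<open>
  At time \<open>k\<close> the ordered pair \<open>(initiator k \<omega>, partner k \<omega>)\<close> is selected.  The sets
  \<open>Ep k\<close> and \<open>Em k\<close> are the events that the initiator, respectively the partner, receives
  the state of the other node.  Only the pair \<open>(Ep k, Em k)\<close> is independent over time
  and of the selection process; the dependence between \<open>Ep k\<close> and \<open>Em k\<close> is left open.
  Independence of the two processes is independence of the sigma-algebras they generate.
\<close>

locale gossip_model = prob_space M
  for M :: "'a measure" +
  fixes A :: "real ^ 'n ^ 'n"
    and initiator partner :: "nat \<Rightarrow> 'a \<Rightarrow> 'n"
    and Ep Em :: "nat \<Rightarrow> 'a set"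
    and Pp Pm :: "nat \<Rightarrow> real"
  assumes initiator_prob:
      "\<And>k i. \<P>(\<omega> in M. initiator k \<omega> = i) = 1 / real CARD('n)"
    and partner_prob:
      "\<And>k i j. \<P>(\<omega> in M. partner k \<omega> = j \<bar> initiator k \<omega> = i) = A $ i $ j"
    and selection_indep:
      "indep_vars (\<lambda>_. count_space UNIV) (\<lambda>k \<omega>. (initiator k \<omega>, partner k \<omega>)) UNIV"
    and Ep_event: "\<And>k. Ep k \<in> events"
    and Em_event: "\<And>k. Em k \<in> events"
    and Pp_range: "\<And>k. Pp k \<in> {0..1}"
    and Pm_range: "\<And>k. Pm k \<in> {0..1}"
    and Ep_prob: "\<And>k. prob (Ep k) = Pp k"
    and Em_prob: "\<And>k. prob (Em k) = Pm k"
    and communication_indep: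
      "indep_vars (\<lambda>_. count_space UNIV) (\<lambda>k \<omega>. (\<omega> \<in> Ep k, \<omega> \<in> Em k)) UNIV"
    and selection_communication_indep:
      "indep_set
         (sets (vimage_algebra (space M) (\<lambda>\<omega> k. (initiator k \<omega>, partner k \<omega>))
                  (Pi\<^sub>M UNIV (\<lambda>_. count_space UNIV))))
         (sets (vimage_algebra (space M) (\<lambda>\<omega> k. (\<omega> \<in> Ep k, \<omega> \<in> Em k))
                  (Pi\<^sub>M UNIV (\<lambda>_. count_space UNIV))))"

text \<open>
  One step when \<open>(i, j)\<close> is selected; \<open>p\<close> and \<open>m\<close> say whether \<open>i\<close> and \<open>j\<close> receive,
  respectively.  If \<open>i = j\<close> the state is unchanged.
\<close>

definition gossip_step :: "'n \<Rightarrow> 'n \<Rightarrow> bool \<Rightarrow> bool \<Rightarrow> real ^ 'n \<Rightarrow> real ^ 'n" where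
  "gossip_step i j p m x =
     (\<chi> l. if l = i \<and> p then (1/2) * x $ i + (1/2) * x $ j
           else if l = j \<and> m then (1/2) * x $ j + (1/2) * x $ i
           else x $ l)"

text \<open>
  The state at time \<open>k\<close> when started in \<open>x0\<close> at time \<open>k0\<close>; the value for \<open>k < k0\<close> is a
  convention without significance.
\<close>

primrec gossip_state ::
    "(nat \<Rightarrow> 'a \<Rightarrow> 'n) \<Rightarrow> (nat \<Rightarrow> 'a \<Rightarrow> 'n) \<Rightarrow> (nat \<Rightarrow> 'a set) \<Rightarrow> (nat \<Rightarrow> 'a set) \<Rightarrow>
     nat \<Rightarrow> real ^ 'n \<Rightarrow> nat \<Rightarrow> 'a \<Rightarrow> real ^ 'n" where
  "gossip_state initiator partner Ep Em k0 x0 0 \<omega> = x0"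
| "gossip_state initiator partner Ep Em k0 x0 (Suc k) \<omega> =
     (if k < k0 then x0
      else gossip_step (initiator k \<omega>) (partner k \<omega>) (\<omega> \<in> Ep k) (\<omega> \<in> Em k)
             (gossip_state initiator partner Ep Em k0 x0 k \<omega>))"

definition disagreement :: "real ^ 'n \<Rightarrow> real" where
  "disagreement x = Max (range (\<lambda>i. x $ i)) - Min (range (\<lambda>i. x $ i))"

definition global_as_consensus ::
    "'a measure \<Rightarrow> (nat \<Rightarrow> 'a \<Rightarrow> 'n::finite) \<Rightarrow> (nat \<Rightarrow> 'a \<Rightarrow> 'n::finite) \<Rightarrow>
     (nat \<Rightarrow> 'a set) \<Rightarrow> (nat \<Rightarrow> 'a set) \<Rightarrow> nat \<Rightarrow> bool" where
  "global_as_consensus M initiator partner Ep Em k0 \<longleftrightarrow>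
     (\<forall>x0 :: real ^ 'n.
        \<P>(\<omega> in M. (\<lambda>k. disagreement (gossip_state initiator partner Ep Em k0 x0 k \<omega>))
                    \<longlonglongrightarrow> 0) = 1)"

end

theory Submission
  imports Defs
begin

text \<open>
  The disagreement \<open>H\<close> never increases, so a.s. consensus is equivalent to convergence of its
  expectation to 0.  Averaging over the choices at time \<open>k\<close> turns \<open>f\<close> into \<open>T\<^sub>k f\<close> for a Markov
  operator \<open>T\<^sub>k\<close>, and \<open>T\<^sub>k\<close> is the identity up to the probability \<open>q\<^sub>k\<close> of a reception, where
  \<open>q\<^sub>k \<le> P\<^sub>k\<^sup>+ + P\<^sub>k\<^sup>- \<le> 2 q\<^sub>k\<close>.

  Sufficiency: let \<open>G\<^sub>r\<close> be the largest expected disagreement after \<open>r\<close> steps with a reception, when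
  an adversary decides who receives.  Spreading low values from one center and high values from the
  other shows \<open>G\<^sub>2\<^sub>n \<le> (1 - \<beta>) H\<close>.  As \<open>T\<^sub>k G\<^sub>r \<le> (1 - q\<^sub>k) G\<^sub>r + q\<^sub>k G\<^sub>r\<^sub>+\<^sub>1\<close>, telescoping shows that
  \<open>F = G\<^sub>0 + \<dots> + G\<^sub>2\<^sub>n\<^sub>-\<^sub>1\<close> satisfies \<open>T\<^sub>k F \<le> (1 - \<gamma> q\<^sub>k) F\<close>, so the expectation of \<open>F \<ge> H\<close> tends to 0.

  Necessity: for \<open>n \<ge> 3\<close>, at most one unordered pair can bring a state of disagreement to exact
  consensus, and \<open>A\<close> admits a second one; so the expectation of \<open>H\<close> stays positive at all times.
  From a time after which the \<open>q\<^sub>k\<close> sum to at most \<open>1/2\<close>, it loses at most half of its value.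
\<close>

subsection \<open>Disagreement and gossip steps\<close>

lemma disagreement_le:
  fixes x :: "real ^ 'n"
  assumes "\<And>l. lo \<le> x $ l" "\<And>l. x $ l \<le> hi"
  shows "disagreement x \<le> hi - lo"
proof -
  have "Max (range (\<lambda>i. x $ i)) \<le> hi" "lo \<le> Min (range (\<lambda>i. x $ i))"
    using assms by (subst Max_le_iff Min_ge_iff; auto)+
  then show ?thesis unfolding disagreement_def by linarith
qed

lemma disagreement_ge: "x $ i - x $ j \<le> disagreement x"
  for x :: "real ^ 'n"
proof -
  have "x $ i \<le> Max (range (\<lambda>i. x $ i))" "Min (range (\<lambda>i. x $ i)) \<le> x $ j"
    by simp_all
  then show ?thesis unfolding disagreement_def by linarith
qed

lemma disagreement_bounds:
  fixes x :: "real ^ 'n"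
  obtains lo hi where "\<And>l. lo \<le> x $ l" "\<And>l. x $ l \<le> hi" "disagreement x = hi - lo"
  using that[of "Min (range (\<lambda>i. x $ i))" "Max (range (\<lambda>i. x $ i))"]
  by (simp add: disagreement_def)

lemma disagreement_nonneg: "0 \<le> disagreement x"
  using disagreement_ge[of x undefined undefined] by simp

lemma disagreement_pos_iff: "0 < disagreement x \<longleftrightarrow> (\<exists>i j. x $ i \<noteq> x $ j)"
proof
  assume "0 < disagreement x"
  show "\<exists>i j. x $ i \<noteq> x $ j"
  proof (rule ccontr)
    assume "\<nexists>i j. x $ i \<noteq> x $ j"
    then have eq: "x $ l = x $ undefined" for l by blast
    have "disagreement x \<le> x $ undefined - x $ undefined"
      by (intro disagreement_le eq_refl eq eq[symmetric])
    with \<open>0 < disagreement x\<close> show False by simp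
  qed
next
  assume "\<exists>i j. x $ i \<noteq> x $ j"
  then obtain i j where "x $ i \<noteq> x $ j" by blast
  then show "0 < disagreement x"
    using disagreement_ge[of x i j] disagreement_ge[of x j i] by linarith
qed

lemma gossip_step_nth:
  "gossip_step i j p m x $ l =
     (if l = i \<and> p \<or> l = j \<and> m then (x $ i + x $ j) / 2 else x $ l)"
  by (auto simp: gossip_step_def field_simps)

lemma gossip_step_no_reception [simp]: "gossip_step i j False False x = x"
  by (simp add: vec_eq_iff gossip_step_nth)

lemma gossip_step_bounds:
  assumes "\<And>l. lo \<le> x $ l" "\<And>l. x $ l \<le> hi"
  shows "lo \<le> gossip_step i j p m x $ l" "gossip_step i j p m x $ l \<le> hi"
  using assms[of l] assms[of i] assms[of j] by (auto simp: gossip_step_nth)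

lemma disagreement_gossip_step_le: "disagreement (gossip_step i j p m x) \<le> disagreement x"
proof -
  obtain lo hi where b: "\<And>l. lo \<le> x $ l" "\<And>l. x $ l \<le> hi" "disagreement x = hi - lo"
    using disagreement_bounds[of x] by metis
  show ?thesis unfolding b(3)
    by (intro disagreement_le gossip_step_bounds[of lo x hi] b(1,2))
qed

subsection \<open>Averaging over the selected pair and the receptions\<close>

definition pair_average ::
    "real ^ 'n ^ 'n \<Rightarrow> bool \<Rightarrow> bool \<Rightarrow> (real ^ 'n \<Rightarrow> real) \<Rightarrow> real ^ 'n \<Rightarrow> real" where
  "pair_average A p m f x =
     (\<Sum>(i, j)\<in>UNIV. A $ i $ j / real CARD('n) * f (gossip_step i j p m x))"

definition gossip_operator ::
    "real ^ 'n ^ 'n \<Rightarrow> (bool \<times> bool \<Rightarrow> real) \<Rightarrow> (real ^ 'n \<Rightarrow> real) \<Rightarrow> real ^ 'n \<Rightarrow> real" where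
  "gossip_operator A c f x = (\<Sum>(p, m)\<in>UNIV. c (p, m) * pair_average A p m f x)"

lemma gossip_operator_expand:
  "gossip_operator A c f x =
     c (True, True) * pair_average A True True f x + c (True, False) * pair_average A True False f x
   + c (False, True) * pair_average A False True f x + c (False, False) * pair_average A False False f x"
proof -
  have U: "(UNIV :: (bool \<times> bool) set) = {(True, True), (True, False), (False, True), (False, False)}"
    by auto
  show ?thesis unfolding gossip_operator_def U by simp
qed

lemma pair_average_sum:
  "pair_average A p m (\<lambda>x. \<Sum>r\<in>I. f r x) x = (\<Sum>r\<in>I. pair_average A p m (f r) x)"
proof -
  have "pair_average A p m (\<lambda>x. \<Sum>r\<in>I. f r x) x =
    (\<Sum>(i, j)\<in>UNIV. \<Sum>r\<in>I. A $ i $ j / real CARD('a) * f r (gossip_step i j p m x))"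
    by (simp add: pair_average_def sum_distrib_left case_prod_unfold)
  also have "\<dots> = (\<Sum>r\<in>I. pair_average A p m (f r) x)"
    unfolding pair_average_def case_prod_unfold by (rule sum.swap)
  finally show ?thesis .
qed

text \<open>The adversary picks, at each step with a reception, which of the two nodes receive.\<close>

primrec worst_disagreement :: "real ^ 'n ^ 'n \<Rightarrow> nat \<Rightarrow> real ^ 'n \<Rightarrow> real" where
  "worst_disagreement A 0 = disagreement"
| "worst_disagreement A (Suc r) = (\<lambda>x.
     max (pair_average A True True (worst_disagreement A r) x)
       (max (pair_average A True False (worst_disagreement A r) x)
            (pair_average A False True (worst_disagreement A r) x)))"

context
  fixes A :: "real ^ 'n ^ 'n"
  assumes A: "stochastic_matrix A"
begin

lemma weight_nonneg: "0 \<le> A $ i $ j / real CARD('n)"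
  using A by (simp add: stochastic_matrix_def)

lemma weight_sum: "(\<Sum>(i, j)\<in>UNIV. A $ i $ j / real CARD('n)) = 1"
proof -
  have "(\<Sum>(i, j)\<in>UNIV. A $ i $ j / real CARD('n)) = (\<Sum>i\<in>UNIV. \<Sum>j\<in>UNIV. A $ i $ j / real CARD('n))"
    by (simp add: sum.cartesian_product)
  also have "\<dots> = 1"
    using A by (simp add: stochastic_matrix_def flip: sum_divide_distrib)
  finally show ?thesis .
qed

lemma pair_average_const: "pair_average A p m (\<lambda>_. d) x = d"
  using weight_sum unfolding pair_average_def case_prod_unfold sum_distrib_right[symmetric] by simp

lemma pair_average_no_reception [simp]: "pair_average A False False f x = f x"
  using pair_average_const[of False False "f x" x] by (simp add: pair_average_def)

lemma pair_average_le:
  assumes "\<And>i j. f (gossip_step i j p m x) \<le> d"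
  shows "pair_average A p m f x \<le> d"
proof -
  have "pair_average A p m f x \<le> pair_average A p m (\<lambda>_. d) x"
    unfolding pair_average_def case_prod_unfold
    by (intro sum_mono mult_left_mono assms weight_nonneg)
  then show ?thesis by (simp add: pair_average_const)
qed

lemma pair_average_nonneg:
  assumes "\<And>x. 0 \<le> f x"
  shows "0 \<le> pair_average A p m f x"
  unfolding pair_average_def case_prod_unfold
  by (intro sum_nonneg mult_nonneg_nonneg assms weight_nonneg)

lemma pair_average_le_improved:
  assumes le: "\<And>i j. f (gossip_step i j p m x) \<le> d"
    and ij: "f (gossip_step i j p m x) \<le> d - e"
  shows "pair_average A p m f x \<le> d - A $ i $ j / real CARD('n) * e"
proof -
  let ?w = "\<lambda>i j. A $ i $ j / real CARD('n)"
  have "pair_average A p m f x \<le>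
      (\<Sum>(a, b)\<in>UNIV. ?w a b * (d - (if (a, b) = (i, j) then e else 0)))"
    unfolding pair_average_def case_prod_unfold
    by (intro sum_mono mult_left_mono weight_nonneg) (use le ij in auto)
  also have "\<dots> = (\<Sum>(a, b)\<in>UNIV. ?w a b * d - (if (a, b) = (i, j) then ?w i j * e else 0))"
    by (intro sum.cong) (auto simp: algebra_simps)
  also have "\<dots> = (\<Sum>(a, b)\<in>UNIV. ?w a b) * d - ?w i j * e"
    unfolding case_prod_unfold sum_subtractf sum_distrib_right prod.collapse by simp
  finally show ?thesis by (simp add: weight_sum)
qed

lemma gossip_operator_lower:
  assumes "\<And>x. 0 \<le> f x" "\<And>a. 0 \<le> c a"
  shows "c (False, False) * f x \<le> gossip_operator A c f x"
  unfolding gossip_operator_expand using assms pair_average_nonneg[of f, OF assms(1)]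
  by simp

lemma pair_average_pos:
  assumes "\<And>x. 0 \<le> f x" "0 < A $ i $ j" "0 < f (gossip_step i j p m x)"
  shows "0 < pair_average A p m f x"
proof -
  have "0 < A $ i $ j / real CARD('n) * f (gossip_step i j p m x)"
    using assms by simp
  also have "\<dots> \<le> pair_average A p m f x"
    unfolding pair_average_def case_prod_unfold
    by (intro member_le_sum[of "(i, j)" UNIV
          "\<lambda>a. A $ fst a $ snd a / real CARD('n) * f (gossip_step (fst a) (snd a) p m x)",
          unfolded fst_conv snd_conv] mult_nonneg_nonneg weight_nonneg assms(1)) simp_all
  finally show ?thesis .
qed

lemma worst_disagreement_Suc_le:
  assumes "\<And>p m. p \<or> m \<Longrightarrow> pair_average A p m (worst_disagreement A r) x \<le> d"
  shows "worst_disagreement A (Suc r) x \<le> d"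
  using assms by simp

lemma worst_disagreement_nonneg: "0 \<le> worst_disagreement A r x"
proof (induction r arbitrary: x)
  case (Suc r)
  then show ?case using pair_average_nonneg[of "worst_disagreement A r" True True x]
    by (simp add: le_max_iff_disj)
qed (simp add: disagreement_nonneg)

lemma worst_disagreement_le: "worst_disagreement A r x \<le> disagreement x"
proof (induction r arbitrary: x)
  case (Suc r)
  show ?case
    by (intro worst_disagreement_Suc_le pair_average_le order_trans[OF Suc disagreement_gossip_step_le])
qed simp

lemma gossip_operator_worst_disagreement:
  assumes c: "\<And>a. 0 \<le> c a" "(\<Sum>a\<in>UNIV. c a) = 1"
  shows "gossip_operator A c (worst_disagreement A r) x \<le>
     c (False, False) * worst_disagreement A r x + (1 - c (False, False)) * worst_disagreement A (Suc r) x"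
proof -
  let ?W = "worst_disagreement A (Suc r) x"
  have U: "(UNIV :: (bool \<times> bool) set) = {(True, True), (True, False), (False, True), (False, False)}"
    by auto
  have s: "1 - c (False, False) = c (True, True) + c (True, False) + c (False, True)"
    using c(2) unfolding U by simp
  have "c (True, True) * pair_average A True True (worst_disagreement A r) x \<le> c (True, True) * ?W"
    "c (True, False) * pair_average A True False (worst_disagreement A r) x \<le> c (True, False) * ?W"
    "c (False, True) * pair_average A False True (worst_disagreement A r) x \<le> c (False, True) * ?W"
    by (intro mult_left_mono c; simp)+
  then show ?thesis
    unfolding gossip_operator_expand s by (simp only: distrib_right pair_average_no_reception)
qed

end

subsection \<open>Contraction under an adversary\<close>

lemma center_crossing:
  assumes "is_center E c" "c \<in> S" "S \<noteq> UNIV"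
  obtains u v where "(u, v) \<in> E" "u \<in> S" "v \<notin> S"
proof -
  obtain d where d: "d \<notin> S" using assms(3) by blast
  then have "(c, d) \<in> E\<^sup>+" using assms by (auto simp: is_center_def)
  then have "\<exists>u v. (u, v) \<in> E \<and> u \<in> S \<and> v \<notin> S"
    using d
  proof (induction rule: trancl_induct)
    case (base y)
    then show ?case using assms(2) by blast
  next
    case (step y z)
    then show ?case by blast
  qed
  then show ?thesis using that by blast
qed

lemma gossip_step_pull:
  fixes x :: "real ^ 'n"
  assumes b: "\<And>l. lo \<le> x $ l" "\<And>l. x $ l \<le> hi"
    and S: "\<And>l. l \<in> S \<Longrightarrow> x $ l \<le> hi - d" and T: "\<And>l. l \<in> T \<Longrightarrow> lo + d \<le> x $ l" and d: "0 \<le> d"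
  shows "l \<in> S \<Longrightarrow> gossip_step i j p m x $ l \<le> hi - d / 2"
    and "l \<in> T \<Longrightarrow> lo + d / 2 \<le> gossip_step i j p m x $ l"
    and "p \<Longrightarrow> j \<in> S \<Longrightarrow> gossip_step i j p m x $ i \<le> hi - d / 2"
    and "p \<Longrightarrow> j \<in> T \<Longrightarrow> lo + d / 2 \<le> gossip_step i j p m x $ i"
    and "m \<Longrightarrow> i \<in> S \<Longrightarrow> gossip_step i j p m x $ j \<le> hi - d / 2"
    and "m \<Longrightarrow> i \<in> T \<Longrightarrow> lo + d / 2 \<le> gossip_step i j p m x $ j"
  using b[of i] b[of j] S[of i] S[of j] T[of i] T[of j] S[of l] T[of l] d
  by (auto simp: gossip_step_nth field_simps)

text \<open>
  Low nodes (\<open>S\<close>) pull their neighbours down, high nodes (\<open>T\<close>) pull theirs up, and each reception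
  costs at most half of the margin.  An initiator's reception enlarges the set that contains the
  center of the digraph, a partner's reception the set that contains the center of the converse.
\<close>

lemma worst_disagreement_certificate:
  fixes A :: "real ^ 'n ^ 'n"
  assumes A: "stochastic_matrix A"
    and c: "is_center (underlying_digraph A) c" and c': "is_center ((underlying_digraph A)\<inverse>) c'"
    and \<kappa>: "0 \<le> \<kappa>" "\<kappa> \<le> 1" "\<And>i j. 0 < A $ i $ j \<Longrightarrow> 2 * \<kappa> \<le> A $ i $ j / real CARD('n)"
    and b: "\<And>l. lo \<le> x $ l" "\<And>l. x $ l \<le> hi"
    and S: "\<And>l. l \<in> S \<Longrightarrow> x $ l \<le> hi - d" and T: "\<And>l. l \<in> T \<Longrightarrow> lo + d \<le> x $ l"
    and d: "0 \<le> d"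
    and centers: "{c, c'} \<subseteq> S \<union> T"
    and card: "2 * CARD('n) \<le> card S + card T + r + 1"
  shows "worst_disagreement A r x \<le> hi - lo - \<kappa> ^ r * d"
  using b S T d centers card
proof (induction r arbitrary: x S T d)
  note [simp] = A
  have full: "worst_disagreement A r x \<le> hi - lo - \<kappa> ^ r * d"
    if b: "\<And>l. lo \<le> x $ l" "\<And>l. x $ l \<le> hi"
      and "\<And>l. l \<in> S \<Longrightarrow> x $ l \<le> hi - d" "\<And>l. l \<in> T \<Longrightarrow> lo + d \<le> x $ l" "0 \<le> d"
      and ST: "S = UNIV \<or> T = UNIV" for r x S T d
  proof -
    have "disagreement x \<le> hi - lo - d"
      using ST
    proof
      assume "S = UNIV"
      then have "disagreement x \<le> (hi - d) - lo" using that by (intro disagreement_le) auto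
      then show ?thesis by simp
    next
      assume "T = UNIV"
      then have "disagreement x \<le> hi - (lo + d)" using that by (intro disagreement_le) auto
      then show ?thesis by simp
    qed
    moreover have "\<kappa> ^ r * d \<le> d"
      using \<kappa> \<open>0 \<le> d\<close> by (simp add: mult_left_le_one_le power_le_one)
    ultimately show ?thesis using worst_disagreement_le[OF A, of r x] by linarith
  qed
  have card_UNIV: "CARD('n) \<le> card X \<Longrightarrow> X = UNIV" for X :: "'n set"
    by (simp add: card_seteq)
  {
    case 0
    have "S = UNIV \<or> T = UNIV"
    proof (rule ccontr)
      assume "\<not> (S = UNIV \<or> T = UNIV)"
      then have "card S < CARD('n)" "card T < CARD('n)" using card_UNIV by (meson not_le)+
      with 0 show False by linarith
    qed
    then show ?case by (intro full[OF 0(1-5)])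
  next
    case (Suc r)
    show ?case
    proof (cases "S = UNIV \<or> T = UNIV")
      case True
      then show ?thesis by (intro full[OF Suc.prems(1-5)])
    next
      case False
      show ?thesis
      proof (rule worst_disagreement_Suc_le[OF A])
        fix p m :: bool assume pm: "p \<or> m"
        have le: "worst_disagreement A r (gossip_step i j p m x) \<le> hi - lo" for i j
          by (intro order_trans[OF worst_disagreement_le[OF A]] disagreement_le
              gossip_step_bounds[of lo x hi] Suc.prems)
        note bounds = gossip_step_bounds[of lo x hi, OF Suc.prems(1,2)]
        note pull = gossip_step_pull[of lo x hi S d T, OF Suc.prems(1-5)]
        have "\<exists>i j. 0 < A $ i $ j \<and>
            worst_disagreement A r (gossip_step i j p m x) \<le> hi - lo - \<kappa> ^ r * (d / 2)"
        proof -
          have grow: "worst_disagreement A r (gossip_step i j p m x) \<le> hi - lo - \<kappa> ^ r * (d / 2)"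
            if v: "v \<in> {i, j}"
              "v \<notin> S \<and> gossip_step i j p m x $ v \<le> hi - d / 2 \<or>
               v \<notin> T \<and> lo + d / 2 \<le> gossip_step i j p m x $ v" for i j v
            using v(2)
          proof
            assume *: "v \<notin> S \<and> gossip_step i j p m x $ v \<le> hi - d / 2"
            show ?thesis
              by (rule Suc.IH[of _ "insert v S" _ T])
                (use * Suc.prems(5-7) pull bounds in auto)
          next
            assume *: "v \<notin> T \<and> lo + d / 2 \<le> gossip_step i j p m x $ v"
            show ?thesis
              by (rule Suc.IH[of _ S _ "insert v T"])
                (use * Suc.prems(5-7) pull bounds in auto)
          qed
          show ?thesis
          proof (cases p)
            case True
            obtain X where X: "X = S \<or> X = T" "c \<in> X" using Suc.prems(6) by auto
            moreover have "X \<noteq> UNIV" using X False by auto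
            ultimately obtain j i where "(j, i) \<in> underlying_digraph A" "j \<in> X" "i \<notin> X"
              using center_crossing[OF c] by metis
            then show ?thesis using X True pull
              by (intro exI[of _ i] exI[of _ j] conjI grow[of i])
                (auto simp: underlying_digraph_def)
          next
            case m: False
            with pm have m by simp
            obtain X where X: "X = S \<or> X = T" "c' \<in> X" using Suc.prems(6) by auto
            moreover have "X \<noteq> UNIV" using X False by auto
            ultimately obtain i j where "(i, j) \<in> (underlying_digraph A)\<inverse>" "i \<in> X" "j \<notin> X"
              using center_crossing[OF c'] by metis
            then show ?thesis using X \<open>m\<close> pull
              by (intro exI[of _ i] exI[of _ j] conjI grow[of j])
                (auto simp: underlying_digraph_def)
          qed
        qed
        then obtain i j where ij: "0 < A $ i $ j"
          "worst_disagreement A r (gossip_step i j p m x) \<le> hi - lo - \<kappa> ^ r * (d / 2)"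
          by blast
        have "pair_average A p m (worst_disagreement A r) x \<le>
            hi - lo - A $ i $ j / real CARD('n) * (\<kappa> ^ r * (d / 2))"
          by (rule pair_average_le_improved[OF A]) (fact le ij)+
        also have "\<dots> \<le> hi - lo - 2 * \<kappa> * (\<kappa> ^ r * (d / 2))"
          using \<kappa>(1) \<kappa>(3)[OF ij(1)] Suc.prems(5) by (intro diff_left_mono mult_right_mono) auto
        finally show "pair_average A p m (worst_disagreement A r) x \<le> hi - lo - \<kappa> ^ Suc r * d"
          by simp
      qed
    qed
  }
qed

lemma worst_disagreement_contraction:
  fixes A :: "real ^ 'n ^ 'n"
  assumes A: "stochastic_matrix A"
    and "quasi_strongly_connected (underlying_digraph A)"
    and "quasi_strongly_connected ((underlying_digraph A)\<inverse>)"
  obtains \<beta> where "0 < \<beta>" "\<beta> \<le> 1"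
    "\<And>x. worst_disagreement A (2 * CARD('n)) x \<le> (1 - \<beta>) * disagreement x"
proof -
  obtain c c' where c: "is_center (underlying_digraph A) c"
    and c': "is_center ((underlying_digraph A)\<inverse>) c'"
    using assms by (auto simp: quasi_strongly_connected_def)
  define W where "W = insert 1 ((\<lambda>(i, j). A $ i $ j / (2 * real CARD('n))) ` {(i, j). 0 < A $ i $ j})"
  define \<kappa> where "\<kappa> = Min W"
  have "finite W" unfolding W_def by simp
  moreover have "W \<noteq> {}" unfolding W_def by simp
  ultimately have "\<kappa> \<in> W" and W: "\<And>w. w \<in> W \<Longrightarrow> \<kappa> \<le> w"
    unfolding \<kappa>_def by (rule Min_in, simp)
  then have \<kappa>: "0 < \<kappa>" "\<kappa> \<le> 1" using W[of 1] by (auto simp: W_def)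
  have \<kappa>': "2 * \<kappa> \<le> A $ i $ j / real CARD('n)" if "0 < A $ i $ j" for i j
  proof -
    have "\<kappa> \<le> A $ i $ j / (2 * real CARD('n))"
      using that by (intro W) (auto simp: W_def intro!: image_eqI[of _ _ "(i, j)"])
    then show ?thesis by (simp add: field_simps)
  qed
  let ?r = "2 * CARD('n)"
  have "worst_disagreement A ?r x \<le> (1 - \<kappa> ^ ?r / 2) * disagreement x" for x
  proof -
    obtain lo hi where b: "\<And>l. lo \<le> x $ l" "\<And>l. x $ l \<le> hi" "disagreement x = hi - lo"
      using disagreement_bounds[of x] by metis
    define S where "S = {l. x $ l \<le> hi - (hi - lo) / 2}"
    define T where "T = {l. lo + (hi - lo) / 2 \<le> x $ l}"
    have "lo \<le> hi" using b(1,2)[of undefined] by linarith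
    have "S \<union> T = UNIV" by (auto simp: S_def T_def field_simps)
    have "worst_disagreement A ?r x \<le> hi - lo - \<kappa> ^ ?r * ((hi - lo) / 2)"
      by (rule worst_disagreement_certificate[OF A c c' _ _ \<kappa>' b(1,2), where S = S and T = T])
        (use \<kappa> \<open>S \<union> T = UNIV\<close> \<open>lo \<le> hi\<close> in \<open>auto simp: S_def T_def\<close>)
    then show ?thesis by (simp add: b(3) algebra_simps)
  qed
  moreover have "0 < \<kappa> ^ ?r / 2" "\<kappa> ^ ?r / 2 \<le> 1"
    using \<kappa> power_le_one[of \<kappa> ?r] by auto
  ultimately show ?thesis using that by blast
qed

lemma gossip_lyapunov:
  fixes A :: "real ^ 'n ^ 'n"
  assumes A: "stochastic_matrix A"
    and "quasi_strongly_connected (underlying_digraph A)"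
    and "quasi_strongly_connected ((underlying_digraph A)\<inverse>)"
  obtains F :: "real ^ 'n \<Rightarrow> real" and \<gamma> where "0 < \<gamma>" "\<gamma> \<le> 1" "\<And>x. disagreement x \<le> F x"
    "\<And>c x. (\<And>a. 0 \<le> c a) \<Longrightarrow> (\<Sum>a\<in>UNIV. c a) = 1 \<Longrightarrow>
       gossip_operator A c F x \<le> (1 - (1 - c (False, False)) * \<gamma>) * F x"
proof -
  obtain \<beta> where \<beta>: "0 < \<beta>" "\<beta> \<le> 1"
    "\<And>x. worst_disagreement A (2 * CARD('n)) x \<le> (1 - \<beta>) * disagreement x"
    using worst_disagreement_contraction[OF assms] by metis
  define R where "R = 2 * CARD('n)"
  define F where "F x = (\<Sum>r<R. worst_disagreement A r x)" for x
  have R: "1 \<le> R" by (simp add: R_def Suc_leI)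
  have le: "disagreement x \<le> F x" for x
  proof -
    have "worst_disagreement A 0 x \<le> F x"
      unfolding F_def using R by (intro member_le_sum) (auto simp: worst_disagreement_nonneg[OF A])
    then show ?thesis by (simp add: worst_disagreement.simps)
  qed
  have F_le: "F x \<le> R * disagreement x" for x
    unfolding F_def using sum_bounded_above[of "{..<R}" "\<lambda>r. worst_disagreement A r x" "disagreement x"]
    by (simp add: worst_disagreement_le[OF A])
  have op: "gossip_operator A c F x \<le> (1 - (1 - c (False, False)) * (\<beta> / R)) * F x"
    if c: "\<And>a. 0 \<le> c a" "(\<Sum>a\<in>UNIV. c a) = 1" for c x
  proof -
    let ?q = "1 - c (False, False)"
    have "c (False, False) \<le> (\<Sum>a\<in>UNIV. c a)" by (rule member_le_sum) (use c in auto)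
    then have q: "0 \<le> ?q" using c(2) by simp
    have "gossip_operator A c F x = (\<Sum>r<R. gossip_operator A c (worst_disagreement A r) x)"
      unfolding F_def gossip_operator_expand pair_average_sum
      by (simp add: sum_distrib_left sum.distrib)
    also have "\<dots> \<le> (\<Sum>r<R. c (False, False) * worst_disagreement A r x
                          + ?q * worst_disagreement A (Suc r) x)"
      by (intro sum_mono gossip_operator_worst_disagreement[OF A] c)
    also have "\<dots> = (\<Sum>r<R. worst_disagreement A r x
        + ?q * (worst_disagreement A (Suc r) x - worst_disagreement A r x))"
      by (intro sum.cong refl) (simp only: algebra_simps)
    also have "\<dots> = F x + ?q * (worst_disagreement A R x - worst_disagreement A 0 x)"
      unfolding F_def sum.distrib sum_distrib_left[symmetric]
      using sum_lessThan_telescope[of "\<lambda>r. worst_disagreement A r x" R] by simp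
    also have "\<dots> \<le> F x + ?q * (- \<beta> * disagreement x)"
      using \<beta>(3)[of x] q
      by (intro add_left_mono mult_left_mono)
        (auto simp: R_def worst_disagreement.simps(1) algebra_simps)
    also have "\<dots> \<le> F x + ?q * (- \<beta> * (F x / R))"
    proof -
      have "F x / R \<le> disagreement x" using F_le[of x] R by (simp add: field_simps)
      then have "?q * (\<beta> * (F x / R)) \<le> ?q * (\<beta> * disagreement x)"
        using \<beta>(1) q by (intro mult_left_mono) auto
      then show ?thesis by simp
    qed
    also have "\<dots> = (1 - ?q * (\<beta> / R)) * F x"
      using R by (simp add: field_simps)
    finally show ?thesis .
  qed
  have "\<beta> / R \<le> 1" using \<beta> R by (simp add: divide_le_eq)
  then show ?thesis using that[of "\<beta> / R" F] \<beta>(1) R le op by simp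
qed

subsection \<open>Reaching exact consensus in one step\<close>

lemma gossip_step_to_consensus:
  fixes x :: "real ^ 'n"
  assumes n: "CARD('n) \<ge> 3" and x: "0 < disagreement x"
    and s: "disagreement (gossip_step i j p m x) = 0"
  shows "x $ i \<noteq> x $ j" and "l \<notin> {i, j} \<Longrightarrow> x $ l = (x $ i + x $ j) / 2"
proof -
  let ?y = "gossip_step i j p m x"
  have "card {i, j} \<noteq> CARD('n)" using n card_insert_le_m1[of 2 "{j}" i] by simp
  then obtain l0 where l0: "l0 \<notin> {i, j}" by (metis UNIV_eq_I)
  have eq: "?y $ a = ?y $ b" for a b using s disagreement_pos_iff[of ?y] by force
  have v: "?y $ a = x $ l0" for a using eq[of a l0] l0 by (simp add: gossip_step_nth)
  have other: "x $ l = x $ l0" if "l \<notin> {i, j}" for l using v[of l] that by (simp add: gossip_step_nth)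
  have ne: "x $ i \<noteq> x $ l0 \<or> x $ j \<noteq> x $ l0"
  proof (rule ccontr)
    assume "\<not> ?thesis"
    then have "x $ a = x $ l0" for a using other[of a] by auto
    then show False using x unfolding disagreement_pos_iff by metis
  qed
  have mid: "x $ i + x $ j = 2 * x $ l0" and ij: "x $ i \<noteq> x $ j"
    using v[of i] v[of j] ne by (auto simp: gossip_step_nth split: if_splits)
  show "x $ i \<noteq> x $ j" by (fact ij)
  show "l \<notin> {i, j} \<Longrightarrow> x $ l = (x $ i + x $ j) / 2" using other mid by simp
qed

lemma exists_pair_avoiding_consensus:
  fixes A :: "real ^ 'n ^ 'n"
  assumes n: "CARD('n) \<ge> 3" and qsc: "quasi_strongly_connected (underlying_digraph A)"
    and x: "0 < disagreement x"
  shows "\<exists>i j. 0 < A $ i $ j \<and> (\<forall>p m. 0 < disagreement (gossip_step i j p m x))"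
proof (rule ccontr)
  assume "\<not> ?thesis"
  then have bad: "\<exists>p m. disagreement (gossip_step i j p m x) = 0" if "0 < A $ i $ j" for i j
    using that disagreement_nonneg by (metis order_le_less)
  have ne: "x $ i \<noteq> x $ j" if "0 < A $ i $ j" for i j
    using bad[OF that] gossip_step_to_consensus(1)[OF n x] by blast
  have mid: "x $ l = (x $ i + x $ j) / 2" if "0 < A $ i $ j" "l \<notin> {i, j}" for i j l
    using bad[OF that(1)] gossip_step_to_consensus(2)[OF n x _ that(2)] by blast
  have same: "a \<in> {i, j} \<and> b \<in> {i, j}" if "0 < A $ i $ j" "0 < A $ a $ b" for i j a b
  proof -
    have "a = i \<or> a = j \<or> 2 * x $ a = x $ i + x $ j" "b = i \<or> b = j \<or> 2 * x $ b = x $ i + x $ j"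
      "i = a \<or> i = b \<or> 2 * x $ i = x $ a + x $ b" "j = a \<or> j = b \<or> 2 * x $ j = x $ a + x $ b"
      using mid[OF that(1)] mid[OF that(2)] by force+
    then show ?thesis using ne[OF that(1)] ne[OF that(2)] by (smt (verit) insertI1 insert_iff)
  qed
  obtain c where c: "is_center (underlying_digraph A) c"
    using qsc by (auto simp: quasi_strongly_connected_def)
  obtain d where d: "d \<noteq> c"
  proof -
    have "card {c} \<noteq> CARD('n)" using n by simp
    then show ?thesis using that by (metis UNIV_eq_I singletonI singletonD)
  qed
  have "(c, d) \<in> (underlying_digraph A)\<^sup>+" using c d by (simp add: is_center_def)
  then obtain b where "(c, b) \<in> underlying_digraph A" by (meson converse_tranclE)
  then have cb: "0 < A $ b $ c" by (simp add: underlying_digraph_def)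
  have "v \<in> {b, c}" for v
  proof (cases "v = c")
    case False
    then have "(c, v) \<in> (underlying_digraph A)\<^sup>+" using c by (simp add: is_center_def)
    then obtain u where "(u, v) \<in> underlying_digraph A" by (meson tranclE)
    then show ?thesis using same[OF cb] by (auto simp: underlying_digraph_def)
  qed simp
  then have "UNIV = {b, c}" by blast
  moreover have "card {b, c} \<le> 2" by (simp add: card_insert_if)
  ultimately show False using n by simp
qed

subsection \<open>One-step expectations\<close>

lemma gossip_operator_eq_sum:
  "gossip_operator A c f x =
     (\<Sum>((i, j), (p, m))\<in>UNIV. A $ i $ j / real CARD('n) * c (p, m) * f (gossip_step i j p m x))"
  for A :: "real ^ 'n ^ 'n"
proof -
  have "gossip_operator A c f x =
      (\<Sum>a\<in>UNIV. \<Sum>s\<in>UNIV. A $ fst s $ snd s / real CARD('n) * c a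
         * f (gossip_step (fst s) (snd s) (fst a) (snd a) x))"
    by (simp add: gossip_operator_def pair_average_def sum_distrib_left case_prod_unfold mult_ac)
  also have "\<dots> = (\<Sum>s\<in>UNIV. \<Sum>a\<in>UNIV. A $ fst s $ snd s / real CARD('n) * c a
         * f (gossip_step (fst s) (snd s) (fst a) (snd a) x))"
    by (rule sum.swap)
  also have "\<dots> = (\<Sum>(s, a)\<in>UNIV \<times> UNIV. A $ fst s $ snd s / real CARD('n) * c a
         * f (gossip_step (fst s) (snd s) (fst a) (snd a) x))"
    by (rule sum.cartesian_product)
  finally show ?thesis by (simp add: case_prod_unfold)
qed

text \<open>The state on the canonical sample space of sequences of selections and receptions.\<close>

definition path_state ::
    "nat \<Rightarrow> real ^ 'n \<Rightarrow> nat \<Rightarrow> (nat \<Rightarrow> ('n \<times> 'n) \<times> (bool \<times> bool)) \<Rightarrow> real ^ 'n" where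
  "path_state = gossip_state (\<lambda>k z. fst (fst (z k))) (\<lambda>k z. snd (fst (z k)))
     (\<lambda>k. {z. fst (snd (z k))}) (\<lambda>k. {z. snd (snd (z k))})"

lemma path_state_cong:
  "(\<And>i. i < k \<Longrightarrow> z i = z' i) \<Longrightarrow> path_state k0 x0 k z = path_state k0 x0 k z'"
  unfolding path_state_def by (induction k) auto

lemma gossip_state_eq_path_state:
  "gossip_state initiator partner Ep Em k0 x0 k \<omega> =
     path_state k0 x0 k (\<lambda>i. ((initiator i \<omega>, partner i \<omega>), (\<omega> \<in> Ep i, \<omega> \<in> Em i)))"
  unfolding path_state_def by (induction k) auto

context gossip_model
begin

definition choice :: "nat \<Rightarrow> 'a \<Rightarrow> ('n \<times> 'n) \<times> (bool \<times> bool)" where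
  "choice k \<omega> = ((initiator k \<omega>, partner k \<omega>), (\<omega> \<in> Ep k, \<omega> \<in> Em k))"

definition reception_prob :: "nat \<Rightarrow> bool \<times> bool \<Rightarrow> real" where
  "reception_prob k a = prob ((\<lambda>\<omega>. (\<omega> \<in> Ep k, \<omega> \<in> Em k)) -` {a} \<inter> space M)"

lemma selection_measurable [measurable]:
  "(\<lambda>\<omega>. (initiator k \<omega>, partner k \<omega>)) \<in> measurable M (count_space UNIV)"
  using selection_indep by (auto simp: indep_vars_def2)

lemma reception_measurable [measurable]:
  "(\<lambda>\<omega>. (\<omega> \<in> Ep k, \<omega> \<in> Em k)) \<in> measurable M (count_space UNIV)"
  using communication_indep by (auto simp: indep_vars_def2)

lemma vimage_algebra_coordinate:
  assumes "finite J" "J \<noteq> {}"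
  shows "(\<Inter>j\<in>J. X j -` B j \<inter> space M) \<in>
    sets (vimage_algebra (space M) (\<lambda>\<omega> k. X k \<omega>) (Pi\<^sub>M UNIV (\<lambda>_::nat. count_space UNIV)))"
proof -
  let ?V = "vimage_algebra (space M) (\<lambda>\<omega> k. X k \<omega>) (Pi\<^sub>M UNIV (\<lambda>_::nat. count_space UNIV))"
  have "(\<lambda>\<omega> k. X k \<omega>) \<in> measurable ?V (Pi\<^sub>M UNIV (\<lambda>_. count_space UNIV))"
    by (rule measurable_vimage_algebra1) (simp add: space_PiM)
  then have "X j \<in> measurable ?V (count_space UNIV)" for j
    using measurable_compose[OF _ measurable_component_singleton[of j UNIV]] by force
  from measurable_sets[OF this, of "B j" for j]
  show ?thesis using assms by (intro sets.finite_INT) auto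
qed

lemma prob_selection_reception:
  assumes J: "finite J" "J \<noteq> {}"
  shows "prob (\<Inter>j\<in>J. choice j -` (B j \<times> C j) \<inter> space M) =
    (\<Prod>j\<in>J. prob ((\<lambda>\<omega>. (initiator j \<omega>, partner j \<omega>)) -` B j \<inter> space M)) *
    (\<Prod>j\<in>J. prob ((\<lambda>\<omega>. (\<omega> \<in> Ep j, \<omega> \<in> Em j)) -` C j \<inter> space M))"
proof -
  let ?S = "\<Inter>j\<in>J. (\<lambda>\<omega>. (initiator j \<omega>, partner j \<omega>)) -` B j \<inter> space M"
  let ?R = "\<Inter>j\<in>J. (\<lambda>\<omega>. (\<omega> \<in> Ep j, \<omega> \<in> Em j)) -` C j \<inter> space M"
  have "(\<Inter>j\<in>J. choice j -` (B j \<times> C j) \<inter> space M) = ?S \<inter> ?R"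
    using J by (auto simp: choice_def)
  also have "prob (?S \<inter> ?R) = prob ?S * prob ?R"
    by (rule indep_setD[OF selection_communication_indep]) (rule vimage_algebra_coordinate[OF J])+
  also have "prob ?S = (\<Prod>j\<in>J. prob ((\<lambda>\<omega>. (initiator j \<omega>, partner j \<omega>)) -` B j \<inter> space M))"
    by (rule indep_varsD[OF selection_indep]) (use J in auto)
  also have "prob ?R = (\<Prod>j\<in>J. prob ((\<lambda>\<omega>. (\<omega> \<in> Ep j, \<omega> \<in> Em j)) -` C j \<inter> space M))"
    by (rule indep_varsD[OF communication_indep]) (use J in auto)
  finally show ?thesis .
qed

lemma choice_measurable [measurable]: "choice k \<in> measurable M (count_space UNIV)"
  unfolding measurable_count_space_eq2[OF finite_class.finite_UNIV]
proof (intro conjI ballI)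
  fix z :: "('n \<times> 'n) \<times> (bool \<times> bool)"
  have "choice k -` {z} \<inter> space M =
    ((\<lambda>\<omega>. (initiator k \<omega>, partner k \<omega>)) -` {fst z} \<inter> space M) \<inter>
    ((\<lambda>\<omega>. (\<omega> \<in> Ep k, \<omega> \<in> Em k)) -` {snd z} \<inter> space M)"
    by (auto simp: choice_def)
  also have "\<dots> \<in> events"
    by (intro sets.Int measurable_sets[OF selection_measurable] measurable_sets[OF reception_measurable]) auto
  finally show "choice k -` {z} \<inter> space M \<in> events" .
qed auto

lemma indep_choice: "indep_vars (\<lambda>_. count_space UNIV) choice UNIV"
proof -
  have "indep_vars (\<lambda>_. count_space UNIV) choice J" if J: "J \<noteq> {}" "finite J" for J
  proof -
    define E :: "nat \<Rightarrow> (('n \<times> 'n) \<times> (bool \<times> bool)) set set" where "E j = {B \<times> C | B C. True}" for j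
    have "indep_vars (\<lambda>_. count_space UNIV) choice J \<longleftrightarrow>
      (\<forall>D\<in>Pi J E. prob (\<Inter>j\<in>J. choice j -` D j \<inter> space M) = (\<Prod>j\<in>J. prob (choice j -` D j \<inter> space M)))"
    proof (rule indep_vars_finite[OF J])
      fix j
      show "sets (count_space UNIV) = sigma_sets (space (count_space UNIV)) (E j)"
      proof (intro equalityI subsetI)
        fix D :: "(('n \<times> 'n) \<times> (bool \<times> bool)) set"
        have "{z} \<in> sigma_sets UNIV (E j)" for z
          by (intro sigma_sets.Basic) (auto simp: E_def intro!: exI[of _ "{fst z}"] exI[of _ "{snd z}"])
        then have "(\<Union>z\<in>D. {z}) \<in> sigma_sets UNIV (E j)"
          by (intro sigma_sets_UNION) (auto intro: countable_finite)
        then show "D \<in> sigma_sets (space (count_space UNIV)) (E j)" by simp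
      qed auto
      show "Int_stable (E j)"
        unfolding Int_stable_def E_def by (clarsimp simp: Times_Int_Times) (intro exI, rule refl)
      show "space (count_space UNIV) \<in> E j"
        unfolding E_def space_count_space UNIV_Times_UNIV[symmetric] by blast
    qed auto
    moreover have "prob (\<Inter>j\<in>J. choice j -` D j \<inter> space M) = (\<Prod>j\<in>J. prob (choice j -` D j \<inter> space M))"
      if "D \<in> Pi J E" for D
    proof -
      have "\<forall>j\<in>J. \<exists>B C. D j = B \<times> C" using that by (auto simp: E_def)
      then obtain B C where D: "\<And>j. j \<in> J \<Longrightarrow> D j = B j \<times> C j" by metis
      have "prob (\<Inter>j\<in>J. choice j -` D j \<inter> space M) = prob (\<Inter>j\<in>J. choice j -` (B j \<times> C j) \<inter> space M)"
        using D by simp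
      also have "\<dots> = (\<Prod>j\<in>J. prob ((\<lambda>\<omega>. (initiator j \<omega>, partner j \<omega>)) -` B j \<inter> space M) *
          prob ((\<lambda>\<omega>. (\<omega> \<in> Ep j, \<omega> \<in> Em j)) -` C j \<inter> space M))"
        unfolding prob_selection_reception[OF J(2,1)] prod.distrib ..
      also have "\<dots> = (\<Prod>j\<in>J. prob (choice j -` D j \<inter> space M))"
        using prob_selection_reception[of "{j}" B C for j] D by (intro prod.cong) auto
      finally show ?thesis .
    qed
    ultimately show ?thesis by blast
  qed
  then show ?thesis
    unfolding indep_vars_def2 by (subst indep_sets_finite_index_sets) auto
qed

lemma prob_selection:
  "prob ((\<lambda>\<omega>. (initiator k \<omega>, partner k \<omega>)) -` {(i, j)} \<inter> space M) = A $ i $ j / real CARD('n)"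
proof -
  have "(\<lambda>\<omega>. (initiator k \<omega>, partner k \<omega>)) -` {(i, j)} \<inter> space M =
      {\<omega> \<in> space M. partner k \<omega> = j \<and> initiator k \<omega> = i}"
    by auto
  then show ?thesis
    using partner_prob[of k j i] initiator_prob[of k i] by (simp add: cond_prob_def eq_divide_eq)
qed

lemma prob_choice:
  "prob (choice k -` {((i, j), a)} \<inter> space M) = A $ i $ j / real CARD('n) * reception_prob k a"
  using prob_selection_reception[of "{k}" "\<lambda>_. {(i, j)}" "\<lambda>_. {a}"]
  by (simp add: prob_selection reception_prob_def)

lemma reception_prob_nonneg: "0 \<le> reception_prob k a"
  by (simp add: reception_prob_def)

lemma sum_reception_prob: "(\<Sum>a\<in>UNIV. reception_prob k a) = 1"
proof -
  let ?X = "\<lambda>a. (\<lambda>\<omega>. (\<omega> \<in> Ep k, \<omega> \<in> Em k)) -` {a} \<inter> space M"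
  have "(\<Sum>a\<in>UNIV. reception_prob k a) = prob (\<Union>a. ?X a)"
    unfolding reception_prob_def
    by (rule finite_measure_finite_Union[symmetric])
      (auto simp: disjoint_family_on_def intro!: measurable_sets[OF reception_measurable])
  also have "(\<Union>a. ?X a) = space M" by auto
  finally show ?thesis by (simp add: prob_space)
qed

lemma prob_some_reception: "1 - reception_prob k (False, False) = prob (Ep k \<union> Em k)"
proof -
  have "(\<lambda>\<omega>. (\<omega> \<in> Ep k, \<omega> \<in> Em k)) -` {(False, False)} \<inter> space M = space M - (Ep k \<union> Em k)"
    by auto
  then show ?thesis
    unfolding reception_prob_def using prob_compl[of "Ep k \<union> Em k"] Ep_event Em_event by auto
qed

lemma reception_prob_bounds:
  "Pp k + Pm k \<le> 2 * (1 - reception_prob k (False, False))"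
  "1 - reception_prob k (False, False) \<le> Pp k + Pm k"
proof -
  have "prob (Ep k) \<le> prob (Ep k \<union> Em k)" "prob (Em k) \<le> prob (Ep k \<union> Em k)"
    using Ep_event Em_event by (auto intro!: finite_measure_mono)
  moreover have "prob (Ep k \<union> Em k) \<le> prob (Ep k) + prob (Em k)"
    using Ep_event Em_event by (rule measure_Un_le)
  ultimately show "Pp k + Pm k \<le> 2 * (1 - reception_prob k (False, False))"
    "1 - reception_prob k (False, False) \<le> Pp k + Pm k"
    unfolding prob_some_reception Ep_prob Em_prob by linarith+
qed

context
  fixes k0 :: nat and x0 :: "real ^ 'n"
begin

abbreviation state :: "nat \<Rightarrow> 'a \<Rightarrow> real ^ 'n" where
  "state \<equiv> gossip_state initiator partner Ep Em k0 x0"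

lemma state_eq_path_state: "state k \<omega> = path_state k0 x0 k (restrict (\<lambda>i. choice i \<omega>) {..<k})"
  unfolding gossip_state_eq_path_state by (rule path_state_cong) (simp add: choice_def)

lemma path_state_measurable:
  "path_state k0 x0 k \<in> measurable (Pi\<^sub>M {..<k} (\<lambda>_. count_space UNIV)) (count_space UNIV)"
  by (subst count_space_PiM_finite) (auto intro: countable_finite)

lemma indep_state_choice:
  fixes g :: "real ^ 'n \<Rightarrow> real" and h :: "('n \<times> 'n) \<times> (bool \<times> bool) \<Rightarrow> real"
  shows "indep_var borel (\<lambda>\<omega>. g (state k \<omega>)) borel (\<lambda>\<omega>. h (choice k \<omega>))"
proof -
  have "indep_var borel ((\<lambda>z. g (path_state k0 x0 k z)) \<circ> (\<lambda>\<omega>. restrict (\<lambda>i. choice i \<omega>) {..<k}))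
      borel ((\<lambda>z. h (z k)) \<circ> (\<lambda>\<omega>. restrict (\<lambda>i. choice i \<omega>) {k}))"
  proof (rule indep_var_compose[OF indep_var_restrict[OF indep_choice]])
    show "(\<lambda>z. g (path_state k0 x0 k z)) \<in> borel_measurable (Pi\<^sub>M {..<k} (\<lambda>_. count_space UNIV))"
      by (rule measurable_compose[OF path_state_measurable]) simp
    show "(\<lambda>z. h (z k)) \<in> borel_measurable (Pi\<^sub>M {k} (\<lambda>_. count_space UNIV))"
      by (rule measurable_compose[OF measurable_component_singleton]) auto
  qed auto
  then show ?thesis by (simp add: comp_def state_eq_path_state)
qed

lemma state_measurable [measurable]: "state k \<in> measurable M (count_space UNIV)"
  unfolding state_eq_path_state
  by (rule measurable_compose[OF _ path_state_measurable]) measurable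

lemma state_fun_measurable [measurable]: "(\<lambda>\<omega>. f (state k \<omega>)) \<in> borel_measurable M"
  for f :: "real ^ 'n \<Rightarrow> real"
  by (rule measurable_compose[OF state_measurable]) simp

lemma finite_range_state: "finite (range (state k))"
proof (rule finite_subset)
  show "range (state k) \<subseteq> path_state k0 x0 k ` ({..<k} \<rightarrow>\<^sub>E UNIV)"
    unfolding state_eq_path_state by auto
qed (simp add: finite_PiE)

lemma integrable_state: "integrable M (\<lambda>\<omega>. f (state k \<omega>))"
  for f :: "real ^ 'n \<Rightarrow> real"
proof (rule integrable_const_bound[where B = "Max ((\<lambda>x. \<bar>f x\<bar>) ` range (state k))"])
  show "AE \<omega> in M. norm (f (state k \<omega>)) \<le> Max ((\<lambda>x. \<bar>f x\<bar>) ` range (state k))"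
    using finite_range_state[of k] by (intro AE_I2) (auto intro!: Max_ge)
qed simp

lemma expectation_state_Suc:
  fixes f :: "real ^ 'n \<Rightarrow> real"
  assumes "k0 \<le> k"
  shows "expectation (\<lambda>\<omega>. f (state (Suc k) \<omega>)) =
    expectation (\<lambda>\<omega>. gossip_operator A (reception_prob k) f (state k \<omega>))"
proof -
  define g where "g z x = f (gossip_step (fst (fst z)) (snd (fst z)) (fst (snd z)) (snd (snd z)) x)"
    for z :: "('n \<times> 'n) \<times> (bool \<times> bool)" and x
  have indep: "indep_var borel (\<lambda>\<omega>. g z (state k \<omega>)) borel (\<lambda>\<omega>. of_bool (choice k \<omega> = z) :: real)" for z
    by (rule indep_state_choice)
  have int: "integrable M (\<lambda>\<omega>. of_bool (choice k \<omega> = z) :: real)" for z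
    by (rule integrable_const_bound[where B = 1]) auto
  have E: "expectation (\<lambda>\<omega>. of_bool (choice k \<omega> = z) :: real) = prob (choice k -` {z} \<inter> space M)" for z
  proof -
    have "expectation (\<lambda>\<omega>. of_bool (choice k \<omega> = z) :: real) =
        expectation (indicator (choice k -` {z} \<inter> space M))"
      by (intro Bochner_Integration.integral_cong) (auto simp: indicator_def)
    then show ?thesis by simp
  qed
  have "f (state (Suc k) \<omega>) = (\<Sum>z\<in>UNIV. g z (state k \<omega>) * of_bool (choice k \<omega> = z))" for \<omega>
  proof -
    have "(\<Sum>z\<in>UNIV. g z (state k \<omega>) * of_bool (choice k \<omega> = z)) =
        (\<Sum>z\<in>UNIV. if choice k \<omega> = z then g z (state k \<omega>) else 0)"
      by (intro sum.cong) auto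
    then show ?thesis using assms by (simp add: g_def choice_def)
  qed
  then have "expectation (\<lambda>\<omega>. f (state (Suc k) \<omega>)) =
      expectation (\<lambda>\<omega>. \<Sum>z\<in>UNIV. g z (state k \<omega>) * of_bool (choice k \<omega> = z))"
    by (intro Bochner_Integration.integral_cong refl)
  also have "\<dots> = (\<Sum>z\<in>UNIV. expectation (\<lambda>\<omega>. g z (state k \<omega>) * of_bool (choice k \<omega> = z)))"
    by (intro Bochner_Integration.integral_sum indep_var_integrable[OF indep integrable_state int])
  also have "\<dots> = (\<Sum>z\<in>UNIV. expectation (\<lambda>\<omega>. g z (state k \<omega>)) * prob (choice k -` {z} \<inter> space M))"
    using indep_var_lebesgue_integral[OF indep integrable_state int] by (simp add: E)
  also have "\<dots> = (\<Sum>z\<in>UNIV. expectation (\<lambda>\<omega>. prob (choice k -` {z} \<inter> space M) * g z (state k \<omega>)))"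
    by (simp add: mult.commute)
  also have "\<dots> = expectation (\<lambda>\<omega>. \<Sum>z\<in>UNIV. prob (choice k -` {z} \<inter> space M) * g z (state k \<omega>))"
    by (rule Bochner_Integration.integral_sum[symmetric]) (rule integrable_mult_right, rule integrable_state)
  also have "(\<lambda>\<omega>. \<Sum>z\<in>UNIV. prob (choice k -` {z} \<inter> space M) * g z (state k \<omega>)) =
      (\<lambda>\<omega>. gossip_operator A (reception_prob k) f (state k \<omega>))"
    unfolding gossip_operator_eq_sum
    by (intro ext sum.cong) (auto simp: prob_choice g_def)
  finally show ?thesis .
qed

end

end

subsection \<open>Expected disagreement\<close>

context gossip_model
begin

context
  fixes k0 :: nat and x0 :: "real ^ 'n"
begin

lemma disagreement_state_Suc_le: "disagreement (state k0 x0 (Suc k) \<omega>) \<le> disagreement (state k0 x0 k \<omega>)"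
proof (cases "k < k0")
  case True
  then have "state k0 x0 k \<omega> = x0" by (cases k) auto
  then show ?thesis using True by simp
qed (simp add: disagreement_gossip_step_le)

lemma decseq_disagreement_state: "decseq (\<lambda>k. disagreement (state k0 x0 k \<omega>))"
  by (intro decseq_SucI disagreement_state_Suc_le)

lemma disagreement_state_le: "disagreement (state k0 x0 k \<omega>) \<le> disagreement x0"
  using decseqD[OF decseq_disagreement_state, of 0 k] by simp

lemma AE_consensus_iff_expectation:
  "(AE \<omega> in M. (\<lambda>k. disagreement (state k0 x0 k \<omega>)) \<longlonglongrightarrow> 0) \<longleftrightarrow>
   (\<lambda>k. expectation (\<lambda>\<omega>. disagreement (state k0 x0 k \<omega>))) \<longlonglongrightarrow> 0"
proof
  assume "AE \<omega> in M. (\<lambda>k. disagreement (state k0 x0 k \<omega>)) \<longlonglongrightarrow> 0"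
  then have "(\<lambda>k. expectation (\<lambda>\<omega>. disagreement (state k0 x0 k \<omega>))) \<longlonglongrightarrow> expectation (\<lambda>_. 0)"
    by (intro integral_dominated_convergence[where w = "\<lambda>_. disagreement x0"])
      (auto simp: disagreement_state_le disagreement_nonneg)
  then show "(\<lambda>k. expectation (\<lambda>\<omega>. disagreement (state k0 x0 k \<omega>))) \<longlonglongrightarrow> 0" by simp
next
  assume lim: "(\<lambda>k. expectation (\<lambda>\<omega>. disagreement (state k0 x0 k \<omega>))) \<longlonglongrightarrow> 0"
  define L where "L \<omega> = (INF k. disagreement (state k0 x0 k \<omega>))" for \<omega>
  have bdd: "bdd_below (range (\<lambda>k. disagreement (state k0 x0 k \<omega>)))" for \<omega>
    by (intro bdd_belowI[of _ 0]) (auto simp: disagreement_nonneg)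
  have L: "(\<lambda>k. disagreement (state k0 x0 k \<omega>)) \<longlonglongrightarrow> L \<omega>" for \<omega>
    unfolding L_def by (rule LIMSEQ_decseq_INF[OF bdd decseq_disagreement_state])
  have [measurable]: "L \<in> borel_measurable M"
    by (rule borel_measurable_LIMSEQ_real[OF L]) simp
  have L_nonneg: "0 \<le> L \<omega>" and L_le: "L \<omega> \<le> disagreement (state k0 x0 k \<omega>)" for \<omega> k
    unfolding L_def by (auto intro: cINF_greatest cINF_lower[OF bdd] simp: disagreement_nonneg)
  have int: "integrable M L"
    by (rule integrable_const_bound[where B = "disagreement x0"])
      (use L_nonneg L_le[of _ 0] in auto)
  have "expectation L \<le> expectation (\<lambda>\<omega>. disagreement (state k0 x0 k \<omega>))" for k
    by (intro integral_mono int integrable_state L_le)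
  then have "expectation L \<le> 0"
    using lim by (intro LIMSEQ_le_const[OF lim]) blast
  moreover have "0 \<le> expectation L" by (intro Bochner_Integration.integral_nonneg L_nonneg)
  ultimately have "AE \<omega> in M. L \<omega> = 0"
    using integral_nonneg_eq_0_iff_AE[OF int] L_nonneg by simp
  then show "AE \<omega> in M. (\<lambda>k. disagreement (state k0 x0 k \<omega>)) \<longlonglongrightarrow> 0"
    using L by (elim AE_mp) (auto intro!: AE_I2, metis)
qed

lemma expectation_disagreement_lower:
  assumes A: "stochastic_matrix A" and "k0 \<le> k"
  shows "reception_prob k (False, False) * expectation (\<lambda>\<omega>. disagreement (state k0 x0 k \<omega>))
    \<le> expectation (\<lambda>\<omega>. disagreement (state k0 x0 (Suc k) \<omega>))"
  unfolding expectation_state_Suc[OF \<open>k0 \<le> k\<close>] integral_mult_right_zero[symmetric]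
  by (intro integral_mono integrable_state integrable_mult_right gossip_operator_lower[OF A]
      disagreement_nonneg reception_prob_nonneg)

lemma gossip_operator_reception_pos:
  assumes A: "stochastic_matrix A" and n: "CARD('n) \<ge> 3"
    and qsc: "quasi_strongly_connected (underlying_digraph A)"
    and f: "\<And>x. 0 \<le> f x" "\<And>x. 0 < disagreement x \<Longrightarrow> 0 < f x"
    and x: "0 < disagreement x"
  shows "0 < gossip_operator A (reception_prob k) f x"
proof -
  obtain i j where "0 < A $ i $ j" and ij: "\<And>p m. 0 < disagreement (gossip_step i j p m x)"
    using exists_pair_avoiding_consensus[OF n qsc x] by blast
  then have pos: "0 < pair_average A p m f x" for p m
    by (intro pair_average_pos[OF A f(1)] f(2))
  obtain a where a: "0 < reception_prob k a"
  proof (rule ccontr)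
    assume "\<not> thesis"
    then have "reception_prob k a = 0" for a
      using that[of a] reception_prob_nonneg[of k a] \<open>\<not> thesis\<close> by (metis order_le_less)
    then show False using sum_reception_prob[of k] by simp
  qed
  have "0 < reception_prob k a * pair_average A (fst a) (snd a) f x" using a pos by simp
  also have "\<dots> \<le> gossip_operator A (reception_prob k) f x"
    unfolding gossip_operator_def case_prod_unfold prod.collapse
    using pos reception_prob_nonneg by (intro member_le_sum) (auto simp: less_imp_le)
  finally show ?thesis .
qed

lemma expectation_state_pos:
  fixes f :: "real ^ 'n \<Rightarrow> real"
  assumes A: "stochastic_matrix A" and n: "CARD('n) \<ge> 3"
    and qsc: "quasi_strongly_connected (underlying_digraph A)"
    and f: "\<And>x. 0 \<le> f x" "\<And>x. 0 < disagreement x \<Longrightarrow> 0 < f x"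
    and x0: "0 < disagreement x0"
  shows "0 < expectation (\<lambda>\<omega>. f (state k0 x0 k \<omega>))"
  using f
proof (induction k arbitrary: f)
  case 0
  then show ?case using x0 by (simp add: prob_space)
next
  case (Suc k)
  show ?case
  proof (cases "k < k0")
    case True
    then show ?thesis using Suc.prems x0 by (simp add: prob_space)
  next
    case False
    have "0 \<le> gossip_operator A (reception_prob k) f x" for x
      by (rule order_trans[OF _ gossip_operator_lower[OF A]])
        (auto simp: Suc.prems reception_prob_nonneg)
    then have "0 < expectation (\<lambda>\<omega>. gossip_operator A (reception_prob k) f (state k0 x0 k \<omega>))"
      by (intro Suc.IH gossip_operator_reception_pos[OF A n qsc] Suc.prems)
    then show ?thesis using False expectation_state_Suc[of k0 k f x0] by simp
  qed
qed

lemma expectation_disagreement_tendsto_0: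
  assumes A: "stochastic_matrix A"
    and qsc: "quasi_strongly_connected (underlying_digraph A)"
      "quasi_strongly_connected ((underlying_digraph A)\<inverse>)"
    and div: "(\<Sum>k. ereal (Pp k + Pm k)) = \<infinity>"
  shows "(\<lambda>k. expectation (\<lambda>\<omega>. disagreement (state k0 x0 k \<omega>))) \<longlonglongrightarrow> 0"
proof -
  obtain F :: "real ^ 'n \<Rightarrow> real" and \<gamma> where F: "0 < \<gamma>" "\<gamma> \<le> 1" "\<And>x. disagreement x \<le> F x"
    "\<And>c x. (\<And>a. 0 \<le> c a) \<Longrightarrow> (\<Sum>a\<in>UNIV. c a) = 1 \<Longrightarrow>
       gossip_operator A c F x \<le> (1 - (1 - c (False, False)) * \<gamma>) * F x"
    using gossip_lyapunov[OF A qsc] by metis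
  define v where "v k = expectation (\<lambda>\<omega>. F (state k0 x0 k \<omega>))" for k
  define s where "s k = (\<Sum>i<k. Pp i + Pm i)" for k
  have F_nonneg: "0 \<le> F x" for x using F(3)[of x] disagreement_nonneg[of x] by linarith
  have v_nonneg: "0 \<le> v k" for k unfolding v_def by (intro Bochner_Integration.integral_nonneg F_nonneg)
  have v_Suc: "v (Suc k) \<le> exp (- \<gamma> / 2 * (Pp k + Pm k)) * v k" if "k0 \<le> k" for k
  proof -
    let ?q = "1 - reception_prob k (False, False)"
    have "v (Suc k) \<le> expectation (\<lambda>\<omega>. (1 - ?q * \<gamma>) * F (state k0 x0 k \<omega>))"
      unfolding v_def expectation_state_Suc[OF that]
      by (intro integral_mono integrable_state integrable_mult_right F(4)
          reception_prob_nonneg sum_reception_prob)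
    also have "\<dots> = (1 - ?q * \<gamma>) * v k" by (simp add: v_def)
    also have "\<dots> \<le> exp (- \<gamma> / 2 * (Pp k + Pm k)) * v k"
    proof (rule mult_right_mono[OF _ v_nonneg])
      have "(Pp k + Pm k) * \<gamma> \<le> 2 * ?q * \<gamma>"
        using reception_prob_bounds(1)[of k] F(1) by (intro mult_right_mono) auto
      then have "1 - ?q * \<gamma> \<le> 1 + - \<gamma> / 2 * (Pp k + Pm k)" by (simp add: field_simps)
      also have "\<dots> \<le> exp (- \<gamma> / 2 * (Pp k + Pm k))" by (rule exp_ge_add_one_self)
      finally show "1 - ?q * \<gamma> \<le> exp (- \<gamma> / 2 * (Pp k + Pm k))" .
    qed
    finally show ?thesis .
  qed
  have v_le: "v k \<le> exp (- \<gamma> / 2 * (s k - s k0)) * v k0" if "k0 \<le> k" for k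
    using that
  proof (induction k rule: dec_induct)
    case (step k)
    have "v (Suc k) \<le> exp (- \<gamma> / 2 * (Pp k + Pm k)) * v k" by (rule v_Suc) fact
    also have "\<dots> \<le> exp (- \<gamma> / 2 * (Pp k + Pm k)) * (exp (- \<gamma> / 2 * (s k - s k0)) * v k0)"
      by (intro mult_left_mono step.IH) simp
    also have "\<dots> = exp (- \<gamma> / 2 * (s (Suc k) - s k0)) * v k0"
      unfolding mult.assoc[symmetric] exp_add[symmetric] by (simp add: s_def algebra_simps)
    finally show ?case .
  qed simp
  have "(\<lambda>k. \<Sum>i<k. ereal (Pp i + Pm i)) \<longlonglongrightarrow> (\<Sum>i. ereal (Pp i + Pm i))"
    using Pp_range Pm_range by (intro summable_LIMSEQ summable_ereal_pos) (simp add: add_nonneg_nonneg)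
  then have "filterlim s at_top sequentially"
    unfolding div s_def sum_ereal by (simp only: tendsto_PInfty_eq_at_top)
  then have "filterlim (\<lambda>k. \<gamma> / 2 * (- s k0 + s k)) at_top sequentially"
    using F(1) by (intro filterlim_tendsto_pos_mult_at_top[OF tendsto_const]
        filterlim_tendsto_add_at_top[OF tendsto_const]) simp_all
  then have "filterlim (\<lambda>k. - (\<gamma> / 2 * (- s k0 + s k))) at_bot sequentially"
    by (simp only: filterlim_uminus_at_top)
  then have "(\<lambda>k. exp (- (\<gamma> / 2 * (- s k0 + s k)))) \<longlonglongrightarrow> 0"
    by (rule filterlim_compose[OF exp_at_bot])
  then have lim: "(\<lambda>k. exp (- (\<gamma> / 2 * (- s k0 + s k))) * v k0) \<longlonglongrightarrow> 0"
    by (rule tendsto_mult_left_zero)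
  show ?thesis
  proof (rule tendsto_sandwich[OF _ _ tendsto_const lim])
    show "\<forall>\<^sub>F k in sequentially. 0 \<le> expectation (\<lambda>\<omega>. disagreement (state k0 x0 k \<omega>))"
      by (intro always_eventually allI Bochner_Integration.integral_nonneg disagreement_nonneg)
    have "expectation (\<lambda>\<omega>. disagreement (state k0 x0 k \<omega>)) \<le> v k" for k
      unfolding v_def by (intro integral_mono integrable_state F(3))
    with v_le show "\<forall>\<^sub>F k in sequentially. expectation (\<lambda>\<omega>. disagreement (state k0 x0 k \<omega>))
        \<le> exp (- (\<gamma> / 2 * (- s k0 + s k))) * v k0"
      unfolding eventually_sequentially
      by (intro exI[of _ k0]) (force simp: algebra_simps intro: order_trans)
  qed
qed

lemma expectation_disagreement_not_tendsto_0:
  assumes A: "stochastic_matrix A" and n: "CARD('n) \<ge> 3"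
    and qsc: "quasi_strongly_connected (underlying_digraph A)"
    and fin: "(\<Sum>k. ereal (Pp k + Pm k)) \<noteq> \<infinity>"
    and x0: "0 < disagreement x0"
  shows "\<not> (\<lambda>k. expectation (\<lambda>\<omega>. disagreement (state k0 x0 k \<omega>))) \<longlonglongrightarrow> 0"
proof
  assume lim: "(\<lambda>k. expectation (\<lambda>\<omega>. disagreement (state k0 x0 k \<omega>))) \<longlonglongrightarrow> 0"
  define v where "v k = expectation (\<lambda>\<omega>. disagreement (state k0 x0 k \<omega>))" for k
  define b where "b k = Pp k + Pm k" for k
  have b_nonneg: "0 \<le> b k" for k using Pp_range[of k] Pm_range[of k] by (simp add: b_def)
  have "summable b"
    using summable_real_of_ereal[OF _ fin] b_nonneg by (simp add: b_def[abs_def])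
  then obtain N where N: "\<And>k. N \<le> k \<Longrightarrow> norm (\<Sum>i. b (i + k)) < 1 / 2"
    using suminf_exist_split[of "1 / 2" b] by auto
  define K where "K = max N k0"
  have tail: "(\<Sum>i<m. b (i + K)) \<le> 1 / 2" for m
  proof -
    have "(\<Sum>i<m. b (i + K)) \<le> (\<Sum>i. b (i + K))"
      using \<open>summable b\<close> b_nonneg by (intro sum_le_suminf) (auto simp: summable_iff_shift)
    also have "\<dots> \<le> 1 / 2" using N[of K] by (simp add: K_def)
    finally show ?thesis .
  qed
  have v_pos: "0 < v K"
    unfolding v_def by (rule expectation_state_pos[OF A n qsc disagreement_nonneg _ x0])
  have "(1 - (\<Sum>i<m. b (i + K))) * v K \<le> v (m + K)" for m
  proof (induction m)
    case (Suc m)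
    let ?s = "\<Sum>i<m. b (i + K)" and ?b = "b (m + K)" and ?r = "reception_prob (m + K) (False, False)"
    have "(1 - ?s - ?b) * v K \<le> ?r * ((1 - ?s) * v K)"
    proof -
      have "1 - ?b \<le> ?r" using reception_prob_bounds(2)[of "m + K"] by (simp add: b_def)
      moreover have "0 \<le> ?s" using b_nonneg by (intro sum_nonneg) simp
      moreover have "0 \<le> ?s * ?b" using b_nonneg \<open>0 \<le> ?s\<close> by simp
      ultimately have "1 - ?s - ?b \<le> (1 - ?b) * (1 - ?s)" by (simp add: algebra_simps)
      also have "\<dots> \<le> ?r * (1 - ?s)"
        using \<open>1 - ?b \<le> ?r\<close> tail[of m] by (intro mult_right_mono) auto
      finally show ?thesis using v_pos by (simp add: mult.assoc[symmetric])
    qed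
    also have "\<dots> \<le> ?r * v (m + K)" by (intro mult_left_mono Suc.IH reception_prob_nonneg)
    also have "\<dots> \<le> v (Suc (m + K))"
      unfolding v_def by (rule expectation_disagreement_lower[OF A]) (simp add: K_def)
    finally show ?case by (simp add: algebra_simps)
  qed simp
  moreover have "v K / 2 \<le> (1 - (\<Sum>i<m. b (i + K))) * v K" for m
    using mult_right_mono[of "1 / 2" "1 - (\<Sum>i<m. b (i + K))" "v K"] tail[of m] v_pos by simp
  ultimately have "v K / 2 \<le> v (m + K)" for m by (rule order_trans[rotated])
  moreover have "(\<lambda>m. v (m + K)) \<longlonglongrightarrow> 0"
    using LIMSEQ_ignore_initial_segment[OF lim] by (simp add: v_def)
  ultimately have "v K / 2 \<le> 0" by (intro LIMSEQ_le_const) blast+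
  with v_pos show False by simp
qed

lemma prob_consensus_eq_1_iff:
  "\<P>(\<omega> in M. (\<lambda>k. disagreement (state k0 x0 k \<omega>)) \<longlonglongrightarrow> 0) = 1 \<longleftrightarrow>
   (\<lambda>k. expectation (\<lambda>\<omega>. disagreement (state k0 x0 k \<omega>))) \<longlonglongrightarrow> 0"
proof -
  have "{\<omega> \<in> space M. (\<lambda>k. disagreement (state k0 x0 k \<omega>)) \<longlonglongrightarrow> 0} \<in> events"
    by measurable
  from prob_Collect_eq_1[OF this] show ?thesis
    by (simp add: AE_consensus_iff_expectation)
qed

end

end

theorem theorem4:
  fixes M :: "'a measure"
    and A :: "real ^ 'n ^ 'n"
    and initiator partner :: "nat \<Rightarrow> 'a \<Rightarrow> 'n"
    and Ep Em :: "nat \<Rightarrow> 'a set"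
    and Pp Pm :: "nat \<Rightarrow> real"
    and k0 :: nat
  assumes "CARD('n) \<ge> 3"
    and "stochastic_matrix A"
    and "gossip_model M A initiator partner Ep Em Pp Pm"
    and "\<And>k. prob_space.indep_event M (Ep k) (Em k)"
    and "quasi_strongly_connected (underlying_digraph A)"
    and "quasi_strongly_connected ((underlying_digraph A)\<inverse>)"
  shows "global_as_consensus M initiator partner Ep Em k0 \<longleftrightarrow>
         (\<Sum>k. ereal (Pp k + Pm k)) = \<infinity>"
proof -
  interpret gossip_model M A initiator partner Ep Em Pp Pm by fact
  obtain a b :: 'n where "a \<noteq> b"
  proof -
    have "card {undefined :: 'n} \<noteq> CARD('n)" using assms(1) by simp
    then show ?thesis using that by (metis UNIV_eq_I singletonI)
  qed
  then have pos: "0 < disagreement (axis a 1 :: real ^ 'n)"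
    by (auto simp: disagreement_pos_iff axis_def)
  show ?thesis
    unfolding global_as_consensus_def prob_consensus_eq_1_iff
    using expectation_disagreement_tendsto_0[OF assms(2,5,6)]
      expectation_disagreement_not_tendsto_0[OF assms(2,1,5) _ pos]
    by blast
qed

end
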